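(* Let $\{\theta_x,x\in R^1\}$ be a permanental process with kernel $\Gamma(x,y)$, $x,y\in R^1$. Let $$d(x,y):=\Big(\Gamma(x,x)+\Gamma(y,y)-2\big(\Gamma(x,y)\Gamma(y,x)\big)^{1/2}\Big)^{1/2}.$$ Suppose that for any three different real numbers $x_1,x_2,x_3$, the $3\times 3$ matrix $\{\Gamma(x_i,x_j)\}_{i,j=1,2,3}$ has an inverse that is an $M$-matrix. Then $d(x,y)$ is a metric on $R^1$.
   Context: A permanental process with kernel $\Gamma$ on an index set $T$ is a $\beta$-permanental process for some $\beta>0$, that is, a real valued nonnegative stochastic process $\{\theta_x,x\in T\}$ such that for all $x_1,\dots,x_n\in T$ and all $\alpha_1,\dots,\alpha_n\ge 0$, $$E\Big(\exp\Big(-\tfrac12\sum_{i=1}^n\alpha_i\theta_{x_i}\Big)\Big)=\frac1{|I+\alpha\Gamma|^{\beta}},$$ where on the right-hand side $\Gamma$ denotes the $n\times n$ real matrix $\{\Gamma(x_i,x_j)\}_{i,j=1}^n$, $I$ is the identity matrix, $\alpha$ is the diagonal matrix with diagonal entries $\alpha_1,\dots,\alpha_n$, and $|\cdot|$ is the determinant. (Existence of such a process forces $\Gamma(x,x)\ge0$, $\Gamma(x,y)\Gamma(y,x)\ge 0$ and $\Gamma(x,x)\Gamma(y,y)\ge\Gamma(x,y)\Gamma(y,x)$, so $d$ is well defined.) A real square matrix $M=\{m_{i,j}\}$ is an $M$-matrix if $m_{i,j}\le 0$ for all $i\neq j$, $M$ is nonsingular, and all entries of $M^{-1}$ are nonnegative.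 *)

theory Defs
  imports
    "HOL-Probability.Probability"
    "Jordan_Normal_Form.Determinant"
begin

text \<open>
  Matrices whose size varies inside a formula are the matrices of \<^theory>\<open>Jordan_Normal_Form.Matrix\<close>.
  Since HOL-Analysis uses the same names for its type-indexed matrices, \<open>Matrix.mat\<close> and
  \<open>Determinant.det\<close> are written with their theory names. A list \<open>[x\<^sub>1, \<dots>, x\<^sub>n]\<close> gives the
  points \<open>x\<^sub>1, \<dots>, x\<^sub>n\<close>, with possible repetitions.
\<close>

definition kernel_mat :: "('i \<Rightarrow> 'i \<Rightarrow> real) \<Rightarrow> 'i list \<Rightarrow> real Matrix.mat" where
  "kernel_mat \<Gamma> xs =
     Matrix.mat (length xs) (length xs) (\<lambda>(i, j). \<Gamma> (xs ! i) (xs ! j))"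

text \<open>
  The real power needs no side condition: the left-hand side below is always positive, so the
  determinant cannot vanish for any \<open>\<alpha> \<ge> 0\<close> (as \<open>0 powr \<beta> = 0\<close> and \<open>1 / 0 = 0\<close>), and it is
  continuous in \<open>\<alpha>\<close> with value 1 at \<open>\<alpha> = 0\<close>; hence it is positive.
  The empty list of points only yields \<open>1 = 1\<close>.
\<close>

definition beta_permanental_process ::
  "real \<Rightarrow> 'a measure \<Rightarrow> 'i set \<Rightarrow> ('i \<Rightarrow> 'a \<Rightarrow> real) \<Rightarrow> ('i \<Rightarrow> 'i \<Rightarrow> real) \<Rightarrow> bool" where
  "beta_permanental_process \<beta> M T \<theta> \<Gamma> \<longleftrightarrow>
     prob_space M \<and>
     (\<forall>x\<in>T. \<theta> x \<in> borel_measurable M) \<and>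
     (\<forall>x\<in>T. \<forall>\<omega>\<in>space M. 0 \<le> \<theta> x \<omega>) \<and>
     (\<forall>xs \<alpha>. set xs \<subseteq> T \<and> (\<forall>i<length xs. 0 \<le> \<alpha> i) \<longrightarrow>
        prob_space.expectation M (\<lambda>\<omega>. exp (- (1 / 2) * (\<Sum>i<length xs. \<alpha> i * \<theta> (xs ! i) \<omega>)))
          = 1 / Determinant.det (1\<^sub>m (length xs) + mat_diag (length xs) \<alpha> * kernel_mat \<Gamma> xs) powr \<beta>)"

definition permanental_process ::
  "'a measure \<Rightarrow> 'i set \<Rightarrow> ('i \<Rightarrow> 'a \<Rightarrow> real) \<Rightarrow> ('i \<Rightarrow> 'i \<Rightarrow> real) \<Rightarrow> bool" where
  "permanental_process M T \<theta> \<Gamma> \<longleftrightarrow> (\<exists>\<beta>>0. beta_permanental_process \<beta> M T \<theta> \<Gamma>)"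

definition is_inverse_mat :: "real Matrix.mat \<Rightarrow> real Matrix.mat \<Rightarrow> bool" where
  "is_inverse_mat A B \<longleftrightarrow> square_mat A \<and> inverts_mat A B \<and> inverts_mat B A"

text \<open>The existential quantifier expresses nonsingularity; the inverse \<open>B\<close> is unique.\<close>

definition M_matrix :: "real Matrix.mat \<Rightarrow> bool" where
  "M_matrix A \<longleftrightarrow>
     square_mat A \<and>
     (\<forall>i<dim_row A. \<forall>j<dim_col A. i \<noteq> j \<longrightarrow> A $$ (i, j) \<le> 0) \<and>
     (\<exists>B. is_inverse_mat A B \<and> (\<forall>i<dim_row B. \<forall>j<dim_col B. 0 \<le> B $$ (i, j)))"

definition kernel_dist :: "('i \<Rightarrow> 'i \<Rightarrow> real) \<Rightarrow> 'i \<Rightarrow> 'i \<Rightarrow> real" where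
  "kernel_dist \<Gamma> x y = sqrt (\<Gamma> x x + \<Gamma> y y - 2 * sqrt (\<Gamma> x y * \<Gamma> y x))"

end

theory Submission imports Defs begin

text \<open>
  A \<open>3 \<times> 3\<close> \<open>M\<close>-matrix has positive determinant, so the signs of its entries are those of the
  cofactors of its inverse \<open>G\<close>, that is, \<open>G\<^sub>i\<^sub>k G\<^sub>k\<^sub>j \<le> G\<^sub>i\<^sub>j G\<^sub>k\<^sub>k\<close> and \<open>G\<^sub>i\<^sub>j G\<^sub>j\<^sub>i < G\<^sub>i\<^sub>i G\<^sub>j\<^sub>j\<close>. Both
  inequalities pass to the symmetrization \<open>g\<^sub>i\<^sub>j = sqrt (G\<^sub>i\<^sub>j G\<^sub>j\<^sub>i)\<close>, where they say that
  \<open>g\<^sub>i\<^sub>j \<ge> p\<^sub>i p\<^sub>j\<close> and \<open>g\<^sub>i\<^sub>i \<ge> p\<^sub>i\<^sup>2\<close> for \<open>p\<^sub>i = g\<^sub>i\<^sub>k / sqrt g\<^sub>k\<^sub>k\<close>. With \<open>r\<^sub>i = g\<^sub>i\<^sub>i - p\<^sub>i\<^sup>2\<close> this gives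
  \<open>d(i,j)\<^sup>2 \<le> (p\<^sub>i - p\<^sub>j)\<^sup>2 + r\<^sub>i + r\<^sub>j\<close> and \<open>d(i,k)\<^sup>2 = (p\<^sub>i - p\<^sub>k)\<^sup>2 + r\<^sub>i\<close>, hence the triangle
  inequality through \<open>k\<close>.
\<close>

text \<open>Cramer's rule, kept free of division so that it applies before the determinant
  \<open>d\<close> is known to be nonzero.\<close>

lemma cramer_3:
  fixes a11 a12 a13 a21 a22 a23 a31 a32 a33 x y z :: "'a :: comm_ring_1"
  assumes "a11 * x + a12 * y + a13 * z = p" "a21 * x + a22 * y + a23 * z = q"
    "a31 * x + a32 * y + a33 * z = r"
  defines "d \<equiv> a11 * (a22 * a33 - a23 * a32) - a12 * (a21 * a33 - a23 * a31)
    + a13 * (a21 * a32 - a22 * a31)"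
  shows "d * x = p * (a22 * a33 - a23 * a32) - q * (a12 * a33 - a13 * a32)
      + r * (a12 * a23 - a13 * a22)"
    and "d * y = q * (a11 * a33 - a13 * a31) - p * (a21 * a33 - a23 * a31)
      - r * (a11 * a23 - a13 * a21)"
    and "d * z = p * (a21 * a32 - a22 * a31) - q * (a11 * a32 - a12 * a31)
      + r * (a11 * a22 - a12 * a21)"
  unfolding d_def assms(1-3)[symmetric] by (simp_all add: algebra_simps)

text \<open>Write A and G for the two matrices and \<open>d\<close> for det A. Since A G = I, the
  adjugate of A is \<open>d\<close> times G, and Jacobi's identity for complementary minors turns
  every 2 x 2 minor of G into a signed entry of A divided by \<open>d\<close>. The signs of A then
  decide once \<open>0 < d\<close>. One instance of each inequality suffices, as the indices can be
  permuted.\<close>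

lemma inverse_M_matrix_3_entries:
  fixes a11 a12 a13 a21 a22 a23 a31 a32 a33 :: real
    and g11 g12 g13 g21 g22 g23 g31 g32 g33 :: real
  assumes A_off: "a12 \<le> 0" "a13 \<le> 0" "a21 \<le> 0" "a23 \<le> 0" "a31 \<le> 0" "a32 \<le> 0"
    and G_nonneg: "0 \<le> g11" "0 \<le> g12" "0 \<le> g13" "0 \<le> g21" "0 \<le> g22" "0 \<le> g23"
      "0 \<le> g31" "0 \<le> g32" "0 \<le> g33"
    and AG: "a11 * g11 + a12 * g21 + a13 * g31 = 1"
      "a11 * g12 + a12 * g22 + a13 * g32 = 0"
      "a11 * g13 + a12 * g23 + a13 * g33 = 0"
      "a21 * g11 + a22 * g21 + a23 * g31 = 0"
      "a21 * g12 + a22 * g22 + a23 * g32 = 1"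
      "a21 * g13 + a22 * g23 + a23 * g33 = 0"
      "a31 * g11 + a32 * g21 + a33 * g31 = 0"
      "a31 * g12 + a32 * g22 + a33 * g32 = 0"
      "a31 * g13 + a32 * g23 + a33 * g33 = 1"
  shows "0 < g11" "g12 * g21 < g11 * g22" "g13 * g32 \<le> g12 * g33"
proof -
  define d where "d = a11 * (a22 * a33 - a23 * a32) - a12 * (a21 * a33 - a23 * a31)
    + a13 * (a21 * a32 - a22 * a31)"
  \<comment> \<open>On the diagonal of A G the two off-diagonal products are nonpositive and the sum
    is 1, so the diagonal product is at least 1.\<close>
  have pos: "0 < a \<and> 0 < g"
    if "a * g + b * h + c * k = 1" "b \<le> 0" "c \<le> 0" "0 \<le> g" "0 \<le> h" "0 \<le> k"
    for a b c g h k :: real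
  proof -
    have "b * h \<le> 0" "c * k \<le> 0"
      using that by (auto intro: mult_nonpos_nonneg)
    then have "0 < a * g" using that by linarith
    with \<open>0 \<le> g\<close> show ?thesis by (auto simp: zero_less_mult_iff)
  qed
  have p1: "0 < a11 \<and> 0 < g11"
    using pos[OF AG(1)] A_off G_nonneg by simp
  have p2: "0 < a22 \<and> 0 < g22"
    using pos[of a22 g22 a21 g12 a23 g32] AG(5) A_off G_nonneg by (simp add: algebra_simps)
  have p3: "0 < a33 \<and> 0 < g33"
    using pos[of a33 g33 a31 g13 a32 g23] AG(9) A_off G_nonneg by (simp add: algebra_simps)
  have adj: "d * g11 = a22 * a33 - a23 * a32" "d * g12 = a13 * a32 - a12 * a33"
    "d * g13 = a12 * a23 - a13 * a22" "d * g21 = a23 * a31 - a21 * a33"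
    "d * g22 = a11 * a33 - a13 * a31" "d * g23 = a13 * a21 - a11 * a23"
    "d * g31 = a21 * a32 - a22 * a31" "d * g32 = a12 * a31 - a11 * a32"
    "d * g33 = a11 * a22 - a12 * a21"
    using cramer_3[OF AG(1,4,7)] cramer_3[OF AG(2,5,8)] cramer_3[OF AG(3,6,9)]
    by (simp_all add: d_def algebra_simps)
  have "0 < d"
  proof (rule ccontr)
    assume "\<not> 0 < d"
    \<comment> \<open>If \<open>d\<close> is not positive, the left side of the cofactor identity is
      nonpositive while \<open>s * t\<close> is nonnegative. This leaves \<open>b * c\<close>
      nonnegative, although \<open>b\<close> is nonpositive and \<open>c\<close> positive.\<close>
    have off_zero: "b = 0"
      if "d * g = s * t - b * c" "0 \<le> g" "s \<le> 0" "t \<le> 0" "b \<le> 0" "0 < c" for g s t b c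
    proof -
      have "d * g \<le> 0" using that \<open>\<not> 0 < d\<close> by (intro mult_nonpos_nonneg) auto
      moreover have "0 \<le> s * t" using that by (intro mult_nonpos_nonpos)
      ultimately have "0 \<le> b * c" using that by linarith
      with \<open>b \<le> 0\<close> \<open>0 < c\<close> show "b = 0" by (auto simp: zero_le_mult_iff)
    qed
    \<comment> \<open>A becomes lower triangular, so its determinant is the product of its positive
      diagonal entries.\<close>
    have "a12 = 0" "a13 = 0" "a23 = 0"
      using off_zero[of g12 a13 a32 a12 a33] off_zero[of g13 a12 a23 a13 a22]
        off_zero[of g23 a13 a21 a23 a11] adj A_off G_nonneg p1 p2 p3
      by (simp_all add: mult.commute)
    then have "d = a11 * a22 * a33" by (simp add: d_def)
    with p1 p2 p3 \<open>\<not> 0 < d\<close> show False by simp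
  qed
  have "d * (d * (g11 * g22 - g12 * g21)) = (d * g11) * (d * g22) - (d * g12) * (d * g21)"
    by (simp add: algebra_simps)
  also have "\<dots> = d * a33" unfolding adj by (simp add: d_def algebra_simps)
  finally have "0 < d * (g11 * g22 - g12 * g21)" using \<open>0 < d\<close> p3 by simp
  with \<open>0 < d\<close> show "g12 * g21 < g11 * g22" by (simp add: zero_less_mult_iff)
  \<comment> \<open>The minor of G in rows 1, 3 and columns 2, 3 has complementary entry
    \<open>a12\<close> in A, with sign -1.\<close>
  have "d * (d * (g12 * g33 - g13 * g32)) = (d * g12) * (d * g33) - (d * g13) * (d * g32)"
    by (simp add: algebra_simps)
  also have "\<dots> = d * (- a12)" unfolding adj by (simp add: d_def algebra_simps)
  finally have "d * (g12 * g33 - g13 * g32) = - a12"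
    by (rule mult_left_cancel[THEN iffD1, rotated]) (use \<open>0 < d\<close> in simp)
  then have "0 \<le> d * (g12 * g33 - g13 * g32)" using A_off by simp
  with \<open>0 < d\<close> show "g13 * g32 \<le> g12 * g33" by (simp add: zero_le_mult_iff)
  show "0 < g11" using p1 by simp
qed

lemma kernel_mat_inverse_M_matrix_3:
  assumes "is_inverse_mat (kernel_mat \<Gamma> [x, y, z]) A" and "M_matrix A"
  shows "0 < \<Gamma> x x" "0 \<le> \<Gamma> x y" "\<Gamma> x y * \<Gamma> y x < \<Gamma> x x * \<Gamma> y y"
    "\<Gamma> x z * \<Gamma> z y \<le> \<Gamma> x y * \<Gamma> z z"
proof -
  define G where "G = kernel_mat \<Gamma> [x, y, z]"
  have G: "G \<in> carrier_mat 3 3" by (intro carrier_matI) (simp_all add: G_def kernel_mat_def)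
  have GA: "G * A = 1\<^sub>m 3" and AG: "A * G = 1\<^sub>m (dim_row A)"
    using assms(1) G by (auto simp: G_def[symmetric] is_inverse_mat_def inverts_mat_def)
  have "dim_col A = 3" using arg_cong[OF GA, of dim_col] by simp
  then have A: "A \<in> carrier_mat 3 3"
    using assms(2) by (auto simp: M_matrix_def)
  obtain B where AB: "is_inverse_mat A B"
    and B_nonneg: "\<forall>i<dim_row B. \<forall>j<dim_col B. 0 \<le> B $$ (i, j)"
    using assms(2) by (auto simp: M_matrix_def)
  have AB1: "A * B = 1\<^sub>m 3" and BA: "B * A = 1\<^sub>m (dim_row B)"
    using AB A by (auto simp: is_inverse_mat_def inverts_mat_def)
  have "dim_col B = 3" "dim_row B = 3"
    using arg_cong[OF AB1, of dim_col] arg_cong[OF BA, of dim_col] A by auto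
  then have B: "B \<in> carrier_mat 3 3" by auto
  \<comment> \<open>Uniqueness of inverses: the nonnegative inverse provided by
    \<open>M_matrix A\<close> is the kernel matrix itself, so the kernel entries are
    nonnegative.\<close>
  have "B = (G * A) * B" using B GA by simp
  also have "\<dots> = G" using assoc_mult_mat[OF G A B] AB1 G by simp
  finally have "B = G" .
  define xs where "xs = [x, y, z]"
  have xs: "xs ! 0 = x" "xs ! 1 = y" "xs ! 2 = z" by (simp_all add: xs_def)
  have Gij: "G $$ (i, j) = \<Gamma> (xs ! i) (xs ! j)" if "i < 3" "j < 3" for i j
    using that by (simp add: G_def kernel_mat_def xs_def)
  have nonneg: "0 \<le> \<Gamma> (xs ! i) (xs ! j)" if "i < 3" "j < 3" for i j
    using B_nonneg that G unfolding \<open>B = G\<close> by (simp flip: Gij)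
  have off: "A $$ (i, j) \<le> 0" if "i < 3" "j < 3" "i \<noteq> j" for i j
    using assms(2) A that by (auto simp: M_matrix_def)
  have sum3: "(\<Sum>k<3. f k) = f 0 + f 1 + f 2" for f :: "nat \<Rightarrow> real"
    by (simp add: eval_nat_numeral)
  have prod: "A $$ (i, 0) * \<Gamma> x (xs ! j) + A $$ (i, 1) * \<Gamma> y (xs ! j) + A $$ (i, 2) * \<Gamma> z (xs ! j)
      = (if i = j then 1 else 0)" if "i < 3" "j < 3" for i j
  proof -
    have "(\<Sum>k<3. A $$ (i, k) * G $$ (k, j)) = (A * G) $$ (i, j)"
      using A G that by (simp add: scalar_prod_def atLeast0LessThan)
    also have "\<dots> = (if i = j then 1 else 0)" using AG A that by simp
    finally show ?thesis
      using that by (simp add: Gij xs sum3 split del: if_split del: One_nat_def)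
  qed
  have diag_prod: "A $$ (i, 0) * \<Gamma> x (xs ! i) + A $$ (i, 1) * \<Gamma> y (xs ! i)
      + A $$ (i, 2) * \<Gamma> z (xs ! i) = 1" if "i < 3" for i
    using prod[OF that that] by simp
  have off_prod: "A $$ (i, 0) * \<Gamma> x (xs ! j) + A $$ (i, 1) * \<Gamma> y (xs ! j)
      + A $$ (i, 2) * \<Gamma> z (xs ! j) = 0" if "i < 3" "j < 3" "i \<noteq> j" for i j
    using prod[OF that(1,2)] that(3) by simp
  have lt: "0 < (3::nat)" "1 < (3::nat)" "2 < (3::nat)" by simp_all
  have ne: "0 \<noteq> (1::nat)" "0 \<noteq> (2::nat)" "1 \<noteq> (0::nat)" "1 \<noteq> (2::nat)" "2 \<noteq> (0::nat)" "2 \<noteq> (1::nat)" by simp_all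
  note entries = inverse_M_matrix_3_entries[OF
      off[OF lt(1) lt(2) ne(1)]
      off[OF lt(1) lt(3) ne(2)]
      off[OF lt(2) lt(1) ne(3)]
      off[OF lt(2) lt(3) ne(4)]
      off[OF lt(3) lt(1) ne(5)]
      off[OF lt(3) lt(2) ne(6)]
      nonneg[OF lt(1) lt(1), unfolded xs] nonneg[OF lt(1) lt(2), unfolded xs] nonneg[OF lt(1) lt(3), unfolded xs]
      nonneg[OF lt(2) lt(1), unfolded xs] nonneg[OF lt(2) lt(2), unfolded xs] nonneg[OF lt(2) lt(3), unfolded xs]
      nonneg[OF lt(3) lt(1), unfolded xs] nonneg[OF lt(3) lt(2), unfolded xs] nonneg[OF lt(3) lt(3), unfolded xs]
      diag_prod[OF lt(1), unfolded xs]
      off_prod[OF lt(1) lt(2) ne(1), unfolded xs]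
      off_prod[OF lt(1) lt(3) ne(2), unfolded xs]
      off_prod[OF lt(2) lt(1) ne(3), unfolded xs]
      diag_prod[OF lt(2), unfolded xs]
      off_prod[OF lt(2) lt(3) ne(4), unfolded xs]
      off_prod[OF lt(3) lt(1) ne(5), unfolded xs]
      off_prod[OF lt(3) lt(2) ne(6), unfolded xs]
      diag_prod[OF lt(3), unfolded xs]]
  show "0 < \<Gamma> x x" "\<Gamma> x y * \<Gamma> y x < \<Gamma> x x * \<Gamma> y y" "\<Gamma> x z * \<Gamma> z y \<le> \<Gamma> x y * \<Gamma> z z"
    by (rule entries)+
  show "0 \<le> \<Gamma> x y" by (rule nonneg[OF lt(1,2), unfolded xs])
qed

text \<open>After squaring, the claim is \<open>- sqrt (P * Q) \<le> c + u - v - w\<close>, with P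
  and Q the radicands on the right. The number \<open>(c - v) * (c - w) / c\<close> lies in between:
  its square is at most \<open>P * Q\<close> because P exceeds \<open>(c - v)\<^sup>2 / c\<close> by
  \<open>a - v\<^sup>2 / c\<close>, and Q likewise, and it equals
  \<open>c - v - w + v * w / c\<close>.\<close>

lemma sqrt_triangle_of_dominated_rank_one:
  fixes a b c u v w :: real
  assumes "0 < c" and "v\<^sup>2 \<le> a * c" and "w\<^sup>2 \<le> b * c" and "v * w \<le> u * c"
  shows "sqrt (a + b - 2 * u) \<le> sqrt (a + c - 2 * v) + sqrt (c + b - 2 * w)"
proof -
  let ?P = "a + c - 2 * v" and ?Q = "c + b - 2 * w" and ?T = "(c - v) * (c - w) / c"
  have P: "(c - v)\<^sup>2 / c \<le> ?P" and Q: "(c - w)\<^sup>2 / c \<le> ?Q"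
    unfolding pos_divide_le_eq[OF \<open>0 < c\<close>] using assms
    by (simp_all add: power2_eq_square algebra_simps)
  have P0: "0 \<le> ?P" and Q0: "0 \<le> ?Q"
    using P Q \<open>0 < c\<close> by (meson divide_nonneg_pos order_trans zero_le_power2)+
  have "?T\<^sup>2 = ((c - v)\<^sup>2 / c) * ((c - w)\<^sup>2 / c)"
    by (simp add: power2_eq_square)
  also have "\<dots> \<le> ?P * ?Q"
    using P Q P0 \<open>0 < c\<close> by (intro mult_mono) auto
  finally have "\<bar>?T\<bar> \<le> sqrt (?P * ?Q)"
    by (metis real_sqrt_abs real_sqrt_le_mono)
  then have "- sqrt (?P * ?Q) \<le> ?T"
    by (metis abs_le_D2 minus_le_iff)
  also have "?T \<le> c + u - v - w"
  proof -
    have "(c - v) * (c - w) \<le> (c + u - v - w) * c" using assms by (simp add: algebra_simps)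
    with \<open>0 < c\<close> show ?thesis by (simp add: pos_divide_le_eq)
  qed
  finally have "a + b - 2 * u \<le> ?P + ?Q + 2 * sqrt (?P * ?Q)" by linarith
  also have "\<dots> = (sqrt ?P + sqrt ?Q)\<^sup>2"
    using P0 Q0 by (simp add: power2_sum real_sqrt_mult)
  finally show ?thesis
    using P0 Q0 by (intro real_le_lsqrt) auto
qed

theorem lemma4p4:
  fixes M :: "'a measure"
    and \<theta> :: "real \<Rightarrow> 'a \<Rightarrow> real"
    and \<Gamma> :: "real \<Rightarrow> real \<Rightarrow> real"
  assumes "permanental_process M UNIV \<theta> \<Gamma>"
    and "\<And>x\<^sub>1 x\<^sub>2 x\<^sub>3 :: real. distinct [x\<^sub>1, x\<^sub>2, x\<^sub>3] \<Longrightarrow>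
           \<exists>A. is_inverse_mat (kernel_mat \<Gamma> [x\<^sub>1, x\<^sub>2, x\<^sub>3]) A \<and> M_matrix A"
  shows "Metric_space UNIV (kernel_dist \<Gamma>)"
proof -
  \<comment> \<open>The hypothesis speaks of triples only; a pair is completed to one by a point
    beyond both.\<close>
  have third: "\<exists>z::real. distinct [x, y, z]" if "x \<noteq> y" for x y
  proof -
    have "distinct [x, y, max x y + 1]" using that by auto
    then show ?thesis ..
  qed
  have triple: "0 < \<Gamma> x x \<and> 0 \<le> \<Gamma> x y \<and> \<Gamma> x y * \<Gamma> y x < \<Gamma> x x * \<Gamma> y y \<and>
      \<Gamma> x z * \<Gamma> z y \<le> \<Gamma> x y * \<Gamma> z z" if "distinct [x, y, z]" for x y z
    using assms(2)[OF that] kernel_mat_inverse_M_matrix_3[of \<Gamma> x y z] by blast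
  have pair: "0 < \<Gamma> x x \<and> 0 \<le> \<Gamma> x y \<and> \<Gamma> x y * \<Gamma> y x < \<Gamma> x x * \<Gamma> y y" if "x \<noteq> y" for x y
    using third[OF that] triple by blast
  have diag: "0 < \<Gamma> x x" for x
    using pair[of x "x + 1"] by simp
  define g where "g x y = sqrt (\<Gamma> x y * \<Gamma> y x)" for x y
  have g_sym: "g x y = g y x" for x y by (simp add: g_def mult.commute)
  have g_diag: "g x x = \<Gamma> x x" for x using diag[of x] by (simp add: g_def)
  have d_eq: "kernel_dist \<Gamma> x y = sqrt (\<Gamma> x x + \<Gamma> y y - 2 * g x y)" for x y
    by (simp add: kernel_dist_def g_def)
  have g_sq: "(g x y)\<^sup>2 < \<Gamma> x x * \<Gamma> y y" if "x \<noteq> y" for x y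
    using pair[OF that] pair[OF that[symmetric]] by (simp add: g_def)
  have d_self: "kernel_dist \<Gamma> x x = 0" for x by (simp add: d_eq g_diag)
  have d_pos: "0 < kernel_dist \<Gamma> x y" if "x \<noteq> y" for x y
  proof -
    \<comment> \<open>Arithmetic-geometric mean inequality for the two diagonal entries.\<close>
    have "(2 * g x y)\<^sup>2 < 4 * (\<Gamma> x x * \<Gamma> y y)"
      using g_sq[OF that] by (simp add: power_mult_distrib)
    also have "\<dots> \<le> (\<Gamma> x x + \<Gamma> y y)\<^sup>2"
      using zero_le_power2[of "\<Gamma> x x - \<Gamma> y y"] by (simp add: power2_eq_square algebra_simps)
    finally have "2 * g x y < \<Gamma> x x + \<Gamma> y y"
      by (rule power2_less_imp_less) (use diag[of x] diag[of y] in simp)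
    then show ?thesis by (simp add: d_eq)
  qed
  have d_nonneg: "0 \<le> kernel_dist \<Gamma> x y" for x y
    using d_self d_pos[of x y] by (cases "x = y") auto
  have d_sym: "kernel_dist \<Gamma> x y = kernel_dist \<Gamma> y x" for x y
    by (simp add: d_eq g_sym add.commute)
  have g_prod: "g x y * g y z \<le> g x z * \<Gamma> y y" if "distinct [x, y, z]" for x y z
  proof -
    \<comment> \<open>The minor inequality with \<open>y\<close> as intermediate point, from
      \<open>x\<close> to \<open>z\<close> and back. The product of the two directions contains
      exactly the factors under the square roots of \<open>g\<close>.\<close>
    have xzy: "\<Gamma> x y * \<Gamma> y z \<le> \<Gamma> x z * \<Gamma> y y" "\<Gamma> z y * \<Gamma> y x \<le> \<Gamma> z x * \<Gamma> y y"
      using triple[of x z y] triple[of z x y] that by auto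
    have nonneg: "0 \<le> \<Gamma> x z" "0 \<le> \<Gamma> z y" "0 \<le> \<Gamma> y x"
      using pair[of x z] pair[of z y] pair[of y x] that by auto
    have "g x y * g y z = sqrt ((\<Gamma> x y * \<Gamma> y z) * (\<Gamma> z y * \<Gamma> y x))"
      by (simp add: g_def mult_ac flip: real_sqrt_mult)
    also have "\<dots> \<le> sqrt ((\<Gamma> x z * \<Gamma> y y) * (\<Gamma> z x * \<Gamma> y y))"
      using xzy nonneg diag[of y] by (intro real_sqrt_le_mono mult_mono[OF xzy]) auto
    also have "\<dots> = g x z * \<Gamma> y y"
      using diag[of y] by (simp add: g_def real_sqrt_mult)
    finally show ?thesis .
  qed
  have d_triangle: "kernel_dist \<Gamma> x z \<le> kernel_dist \<Gamma> x y + kernel_dist \<Gamma> y z" for x y z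
  proof (cases "distinct [x, y, z]")
    case True
    show ?thesis unfolding d_eq
      by (rule sqrt_triangle_of_dominated_rank_one)
        (use True diag[of y] g_sq[of x y] g_sq[of y z] g_prod[of x y z] in
          \<open>auto simp: mult.commute\<close>)
  next
    case False
    then consider "x = y" | "y = z" | "x = z" by auto
    then show ?thesis
      using d_self d_nonneg[of x y] d_sym[of x y] by cases auto
  qed
  show ?thesis
  proof
    show "0 \<le> kernel_dist \<Gamma> x y" for x y by (rule d_nonneg)
    show "kernel_dist \<Gamma> x y = kernel_dist \<Gamma> y x" for x y by (rule d_sym)
    show "kernel_dist \<Gamma> x y = 0 \<longleftrightarrow> x = y" for x y
      using d_self d_pos[of x y] by force
    show "kernel_dist \<Gamma> x z \<le> kernel_dist \<Gamma> x y + kernel_dist \<Gamma> y z" for x y z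
      by (rule d_triangle)
  qed
qed

end
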